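(* Consider numbers of the form $kb-1$ as a product of two positive integers. For every positive integer $k$ there exist a positive integer $b$ with $kb>1$ and positive integers $q,v$ with $qv=kb-1$ and $(q-1)\mid b$, and $$\frac{k}{v}=\frac{1}{\frac{b}{q-1}}+\frac1b+\frac{1}{bv}.$$ This equation is a special case of the following one: for all positive integers $k,c$ there exist positive integers $v$ and $q\ge2$ with $c\mid q-1$, $\frac{qv+c}{k}=b$, $\frac{b}{q-1}=w$, where $b,w$ are positive integers, and $$\frac kv=\frac1w+\frac1b+\frac{1}{\frac{vb}{c}}.$$
   Context: All equations are between rational numbers. *)

theory Defs
  imports Complex_Main
begin

text \<open>
  The variables are integers, so that \<open>q - 1\<close> is not truncated; all fractions are taken in \<^typ>\<open>rat\<close>.
\<close>

definition product_expansion :: "int \<Rightarrow> int \<Rightarrow> int \<Rightarrow> int \<Rightarrow> bool" where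
  "product_expansion k b q v \<longleftrightarrow>
     b > 0 \<and> k * b > 1 \<and> q > 0 \<and> v > 0 \<and> q * v = k * b - 1 \<and> (q - 1) dvd b \<and>
     (of_int k / of_int v :: rat) =
       1 / (of_int b / of_int (q - 1)) + 1 / of_int b + 1 / of_int (b * v)"

text \<open>
  The denominator \<open>v * b / c\<close> of the last term is a rational number, not required to be an integer.
\<close>

definition general_expansion :: "int \<Rightarrow> int \<Rightarrow> int \<Rightarrow> int \<Rightarrow> int \<Rightarrow> int \<Rightarrow> bool" where
  "general_expansion k c b q v w \<longleftrightarrow>
     v > 0 \<and> q \<ge> 2 \<and> c dvd q - 1 \<and> b > 0 \<and> w > 0 \<and>
     (of_int (q * v + c) / of_int k :: rat) = of_int b \<and>
     (of_int b / of_int (q - 1) :: rat) = of_int w \<and>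
     (of_int k / of_int v :: rat) =
       1 / of_int w + 1 / of_int b + 1 / (of_int (v * b) / of_int c)"

end

theory Submission
  imports Defs
begin

text \<open>
  In both expansions the equation between fractions carries no information beyond the integer
  conditions. If \<open>q * v + c = k * b\<close>, then over the common denominator \<open>b * v\<close> the three summands
  \<open>(q - 1) / b\<close>, \<open>1 / b\<close> and \<open>c / (b * v)\<close> add up to \<open>(q * v + c) / (b * v) = k / v\<close>. What remains
  is the single Diophantine condition \<open>q * v + c = k * b\<close> with \<open>c dvd q - 1\<close> and \<open>q - 1 dvd b\<close>.

  Put \<open>d = q - 1\<close> and \<open>b = w * d\<close>. Then \<open>(d + 1) * v + c = k * w * d\<close> forces \<open>v \<equiv> - c\<close> modulo \<open>d\<close>,
  say \<open>v = d * t - c\<close>, and dividing by \<open>d\<close> leaves \<open>k * w = (d + 1) * t - c\<close>. The choice \<open>t = c\<close>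
  turns the right-hand side into \<open>d * c\<close>, so any multiple \<open>d\<close> of \<open>c * k\<close> gives a solution, as long as
  \<open>v = c * (d - 1)\<close> is positive. With \<open>d = c * k\<close> this fails just for \<open>c = k = 1\<close>, whereas
  \<open>d = 2 * c * k\<close> works in all cases. The first expansion is the case \<open>c = 1\<close>.
\<close>

lemma three_term_expansion:
  fixes k b q v c :: "'a::field"
  assumes "b \<noteq> 0" "v \<noteq> 0" "q * v + c = k * b"
  shows "k / v = (q - 1) / b + 1 / b + c / (v * b)"
proof -
  have "(q - 1) / b + 1 / b + c / (v * b) = (q * v + c) / (v * b)"
    using assms(1,2) by (simp add: field_simps)
  also have "\<dots> = k / v"
    using assms by simp
  finally show ?thesis by simp
qed

lemma general_expansion_iff:
  assumes "k > 0"
  shows "general_expansion k c b q v w \<longleftrightarrow>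
    v > 0 \<and> q \<ge> 2 \<and> c dvd q - 1 \<and> w > 0 \<and> q * v + c = k * b \<and> b = w * (q - 1)"
    (is "_ \<longleftrightarrow> ?arith")
proof
  assume gen: "general_expansion k c b q v w"
  have "(of_int (q * v + c) :: rat) = of_int (k * b)"
    using gen assms by (simp add: general_expansion_def field_simps)
  moreover have "(of_int b :: rat) = of_int (w * (q - 1))"
    using gen by (simp add: general_expansion_def divide_eq_eq)
  ultimately show ?arith
    using gen unfolding general_expansion_def of_int_eq_iff by blast
next
  assume arith: ?arith
  hence "b > 0" by simp
  have kb: "(of_int q * of_int v + of_int c :: rat) = of_int k * of_int b"
    using arith by (metis of_int_add of_int_mult)
  have bw: "(of_int b :: rat) = of_int w * of_int (q - 1)"
    using arith by (metis of_int_mult)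
  have q1: "(of_int (q - 1) :: rat) \<noteq> 0" "(of_int w :: rat) \<noteq> 0"
    using arith unfolding of_int_eq_0_iff by auto
  have "(of_int k / of_int v :: rat) =
      (of_int q - 1) / of_int b + 1 / of_int b + of_int c / (of_int v * of_int b)"
    using arith \<open>b > 0\<close> kb by (intro three_term_expansion) auto
  moreover have "(of_int q - 1) / of_int b = (1 / of_int w :: rat)"
    using bw q1 by simp
  ultimately show "general_expansion k c b q v w"
    using arith \<open>b > 0\<close> kb bw q1 assms by (simp add: general_expansion_def)
qed

text \<open>
  The value \<open>q = 1\<close> is excluded on the left-hand side because \<open>q - 1 dvd b\<close> would then make \<open>b\<close>
  vanish.
\<close>

lemma product_expansion_iff_general_expansion:
  assumes "k > 0"
  shows "product_expansion k b q v \<longleftrightarrow> (\<exists>w. general_expansion k 1 b q v w)"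
proof
  assume prod: "product_expansion k b q v"
  then obtain w where w: "b = (q - 1) * w"
    unfolding product_expansion_def by blast
  have "b > 0" "q > 0" "v > 0" "q * v + 1 = k * b"
    using prod by (simp_all add: product_expansion_def)
  moreover have "q \<noteq> 1"
    using w \<open>b > 0\<close> by auto
  moreover from this have "w > 0"
    using w \<open>b > 0\<close> \<open>q > 0\<close> by (simp add: zero_less_mult_iff)
  ultimately have "general_expansion k 1 b q v w"
    using w by (simp add: general_expansion_iff[OF assms])
  thus "\<exists>w. general_expansion k 1 b q v w" ..
next
  assume "\<exists>w. general_expansion k 1 b q v w"
  then obtain w where gen: "general_expansion k 1 b q v w" ..
  hence arith: "v > 0" "q \<ge> 2" "q * v + 1 = k * b" "b = w * (q - 1)"
    by (simp_all add: general_expansion_iff[OF assms])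
  have "q * v > 0"
    using arith by simp
  hence "k * b > 1"
    using arith by linarith
  thus "product_expansion k b q v"
    using gen arith by (simp add: general_expansion_def product_expansion_def mult.commute)
qed

lemma general_expansion_exists:
  assumes "k > 0" "c > 0"
  shows "\<exists>b q v w. general_expansion k c b q v w"
proof -
  define d where "d = 2 * c * k"
  have "c * k > 0"
    using assms by simp
  hence "d \<ge> 2"
    by (simp add: d_def mult.assoc)
  moreover have "c dvd d"
    by (simp add: d_def)
  moreover have "(d + 1) * (c * (d - 1)) + c = k * (2 * c\<^sup>2 * d)"
    by (simp add: d_def algebra_simps power2_eq_square)
  ultimately have "general_expansion k c (2 * c\<^sup>2 * d) (d + 1) (c * (d - 1)) (2 * c\<^sup>2)"
    using assms by (simp add: general_expansion_iff)
  thus ?thesis by blast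
qed

theorem corollary5p3:
  shows "(\<forall>k::int. k > 0 \<longrightarrow> (\<exists>b q v. product_expansion k b q v))
    \<and> (\<forall>k b q v :: int. k > 0 \<longrightarrow>
         (product_expansion k b q v \<longleftrightarrow> (\<exists>w. general_expansion k 1 b q v w)))
    \<and> (\<forall>k c :: int. k > 0 \<longrightarrow> c > 0 \<longrightarrow> (\<exists>b q v w. general_expansion k c b q v w))"
  using general_expansion_exists product_expansion_iff_general_expansion zero_less_one by metis

end
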